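(* Let $n$ be a nonnegative integer such that $2n+1$ is prime. Then \[ \sum_{j=0}^{n-1} t_4(j) \left( \sigma(n-j) - 4\sigma\!\left(\tfrac{n-j}{2}\right) \right) = \frac{n(n+1)}{2}. \]
   Context: $t_4(m)=\#\{(x_1,\dots,x_4)\in\mathbb{N}_0^4 : m=\sum_{i=1}^4\frac{x_i(x_i+1)}{2}\}$, with $\mathbb{N}_0=\{0,1,2,\dots\}$ (so $t_4(0)=1$). The function $\sigma$ is defined on $\mathbb{Q}$ by $\sigma(0)=1$, $\sigma(q)=0$ if $q\in\mathbb{Q}\setminus\mathbb{N}_0$, and $\sigma(q)=\sum_{d\mid q} d$ for $q\in\mathbb{N}=\{1,2,\dots\}$. *)

theory Defs
  imports Complex_Main "HOL-Computational_Algebra.Primes"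
begin

(* Ordered representations; x * (x + 1) is even, so div is exact here. *)
definition t4 :: "nat \<Rightarrow> nat" where
  "t4 m = card {(x1, x2, x3, x4).
     m = x1 * (x1 + 1) div 2 + x2 * (x2 + 1) div 2
       + x3 * (x3 + 1) div 2 + x4 * (x4 + 1) div 2}"

(* Note the convention div_sigma 0 = 1. On positive integers nat \<lfloor>q\<rfloor> is q itself. *)
definition div_sigma :: "rat \<Rightarrow> nat" where
  "div_sigma q = (if q = 0 then 1 else if q \<in> \<nat> then \<Sum>{d. d dvd nat \<lfloor>q\<rfloor>} else 0)"

lemma div_sigma_of_nat: "n > 0 \<Longrightarrow> div_sigma (of_nat n) = \<Sum>{d. d dvd n}"
  by (simp add: div_sigma_def)

lemma finite_t4_set:
  fixes m :: nat
  shows "finite {(x1, x2, x3, x4).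
     m = x1 * (x1 + 1) div 2 + x2 * (x2 + 1) div 2
       + x3 * (x3 + 1) div 2 + x4 * (x4 + 1) div 2}"
proof -
  have le: "x \<le> x * (x + 1) div 2" for x :: nat
    by (cases x) auto
  show ?thesis
    by (rule finite_subset[of _ "{..m} \<times> {..m} \<times> {..m} \<times> {..m}"])
      (auto intro: order_trans[OF le] simp del: mult_Suc_right)
qed

end

theory Submission
  imports Defs "HOL-Computational_Algebra.Formal_Power_Series"
begin

text \<open>
  Write \<open>\<psi> = \<Sum> q\<^bsup>k(k+1)/2\<^esup>\<close>, so that \<open>t\<^sub>4\<close> has the generating function \<open>\<psi>\<^sup>4\<close>, and
  \<open>h(m) = \<sigma>(m) - 4 \<sigma>(m/2) = - \<Sum>\<^bsub>d | m\<^esub> (-1)\<^sup>d d\<close>. By Gauss, \<open>\<psi> = \<Prod> (1 - q\<^sup>2\<^sup>i) / (1 - q\<^sup>2\<^sup>i\<^sup>-\<^sup>1)\<close>, which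
  follows from a finite identity of D. Shanks. The logarithmic derivative gives \<open>q \<psi>' = \<psi> \<Sum> h(m) q\<^sup>m\<close>, whence
  \<open>n t\<^sub>4(n) = 4 \<Sum>\<^bsub>j<n\<^esub> t\<^sub>4(j) h(n-j)\<close>. A Liouville-type sum over the solutions of
  \<open>x y + d e = 2 n + 1\<close> shows that \<open>\<sigma>(2 n + 1)\<close> satisfies the same recurrence, so
  \<open>t\<^sub>4(n) = \<sigma>(2 n + 1)\<close>, which is \<open>2 n + 2\<close> when \<open>2 n + 1\<close> is prime.
\<close>

subsection \<open>Gauss' product and the recurrence for \<open>t\<^sub>4\<close>\<close>

definition triang :: "nat \<Rightarrow> nat" where
  "triang k = k * (k + 1) div 2"

lemma le_triang: "k \<le> triang k"
  unfolding triang_def by (cases k) auto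

lemma triang_even: "triang (2 * n) = n * (2 * n + 1)"
  and triang_odd: "triang (2 * n + 1) = (n + 1) * (2 * n + 1)"
proof -
  have "2 * n * (2 * n + 1) = 2 * (n * (2 * n + 1))"
    "(2 * n + 1) * (2 * n + 1 + 1) = 2 * ((n + 1) * (2 * n + 1))" by algebra+
  then show "triang (2 * n) = n * (2 * n + 1)" "triang (2 * n + 1) = (n + 1) * (2 * n + 1)"
    unfolding triang_def by (metis nonzero_mult_div_cancel_left zero_neq_numeral)+
qed

text \<open>Here \<open>v i\<close> stands for 1 / (1 - q^(2i+1)), so the identity makes sense in
  every commutative ring. Induction on \<open>n\<close>: the change of each old summand is a
  difference in \<open>s\<close>, so the total change telescopes to one boundary term. Together with
  the new summand \<open>s = n\<close> it yields the two new triangular powers.\<close>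

lemma shanks_identity:
  fixes q :: "'a::comm_ring_1" and v :: "nat \<Rightarrow> 'a"
  assumes v: "\<And>i. v i * (1 - q ^ (2 * i + 1)) = 1"
  shows "(\<Sum>s<n. (\<Prod>i=s..<n. (1 - q ^ (2 * i + 2)) * v i) * q ^ (s * (2 * n + 1)))
       = (\<Sum>s<2 * n. q ^ triang s)"
proof (induction n)
  case 0
  then show ?case by simp
next
  case (Suc n)
  define R where "R s m = (\<Prod>i=s..<m. (1 - q ^ (2 * i + 2)) * v i)" for s m
  \<comment> \<open>The telescoping certificate. Its factor \<open>1 - q ^ (2 * s)\<close> vanishes
    at \<open>s = 0\<close>, so only the upper boundary \<open>g n\<close> survives.\<close>
  define g where "g s = R s n * (1 - q ^ (2 * s)) * q ^ (s * (2 * n + 1))" for s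
  have R_step: "R (Suc s) n * (1 - q ^ (2 * s + 2)) = R s n * (1 - q ^ (2 * s + 1))" if "s < n" for s
  proof -
    have "R s n = (1 - q ^ (2 * s + 2)) * v s * R (Suc s) n"
      unfolding R_def using that by (simp add: prod.atLeast_Suc_lessThan)
    then have "R s n * (1 - q ^ (2 * s + 1))
        = (v s * (1 - q ^ (2 * s + 1))) * (R (Suc s) n * (1 - q ^ (2 * s + 2)))"
      by (simp only: ac_simps)
    then show ?thesis by (simp only: v mult_1_left)
  qed
  have R_Suc: "R s (Suc n) = R s n * ((1 - q ^ (2 * n + 2)) * v n)" if "s \<le> n" for s
    unfolding R_def using that by simp
  have telescope: "R s (Suc n) * q ^ (s * (2 * Suc n + 1)) - R s n * q ^ (s * (2 * n + 1))
      = v n * (g (Suc s) - g s)" if "s < n" for s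
  proof -
    define a b c where "a = q ^ (2 * s)" and "b = q ^ (2 * n + 1)" and "c = q ^ (s * (2 * n + 1))"
    have e: "q ^ (s * (2 * Suc n + 1)) = c * a" "q ^ (2 * n + 2) = b * q"
      "q ^ (2 * s + 1) = a * q" "q ^ (Suc s * (2 * n + 1)) = c * b"
      unfolding a_def b_def c_def by (simp_all flip: power_add power_Suc2 add: algebra_simps)
    have "g (Suc s) = (R (Suc s) n * (1 - q ^ (2 * s + 2))) * (c * b)"
      unfolding g_def e by simp
    then have g1: "g (Suc s) = R s n * (1 - a * q) * (c * b)"
      using R_step[OF that] e by simp
    have g0: "g s = R s n * (1 - a) * c" unfolding g_def a_def c_def by simp
    have v1: "v n * (1 - b) = 1" using v[of n] unfolding b_def .
    have "R s (Suc n) * (c * a) = R s n * (1 - b * q) * v n * (c * a)"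
      using R_Suc[of s] that e by (simp add: mult.assoc)
    moreover have "R s n * c = R s n * c * (v n * (1 - b))" using v1 by simp
    \<comment> \<open>With the common factor \<open>R s n * c * v n\<close> taken out, this is (1 -
      b q) a - (1 - b) = (1 - a q) b - (1 - a).\<close>
    ultimately show ?thesis
      unfolding g1 g0 e(1) c_def[symmetric] by (simp add: algebra_simps)
  qed
  define w where "w = q ^ (n * (2 * n + 1))"
  define b where "b = q ^ (2 * n + 1)"
  have v1: "v n * (1 - b) = 1" using v[of n] unfolding b_def .
  have "(\<Sum>s<n. R s (Suc n) * q ^ (s * (2 * Suc n + 1))) - (\<Sum>s<n. R s n * q ^ (s * (2 * n + 1)))
      = v n * (g n - g 0)"
    unfolding sum_subtractf[symmetric] sum_lessThan_telescope[symmetric] sum_distrib_left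
    by (intro sum.cong refl telescope) simp
  also have "\<dots> = v n * ((1 - q ^ (2 * n)) * w)"
    unfolding g_def w_def R_def by simp
  finally have 1: "(\<Sum>s<n. R s (Suc n) * q ^ (s * (2 * Suc n + 1)))
      = (\<Sum>s<2 * n. q ^ triang s) + v n * ((1 - q ^ (2 * n)) * w)"
    using Suc.IH unfolding R_def by (simp add: algebra_simps)
  define a c where "a = q ^ (2 * n)" and "c = q ^ (2 * n + 2)"
  \<comment> \<open>The exponents 2n and 2n + 2 add up to 2(2n + 1). Hence \<open>1 - a * c\<close>
    factors as (1 - b)(1 + b), and \<open>v n\<close> cancels \<open>1 - b\<close>, leaving
    \<open>w + b * w\<close>.\<close>
  have ac: "a * c = b * b"
    unfolding a_def b_def c_def by (simp flip: power_add)
  have "R n (Suc n) * q ^ (n * (2 * Suc n + 1)) = (1 - c) * v n * (a * w)"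
    unfolding R_def w_def a_def c_def by (simp flip: power_add add: algebra_simps)
  then have "v n * ((1 - q ^ (2 * n)) * w) + R n (Suc n) * q ^ (n * (2 * Suc n + 1))
      = v n * w * (1 - a * c)"
    unfolding a_def[symmetric] by (simp add: algebra_simps)
  also have "\<dots> = v n * (1 - b) * ((1 + b) * w)"
    unfolding ac by (simp add: algebra_simps)
  also have "\<dots> = w + b * w"
    unfolding v1 by (simp add: algebra_simps)
  also have "b * w = q ^ ((n + 1) * (2 * n + 1))"
    unfolding b_def w_def by (simp flip: power_add add: algebra_simps)
  finally have 2: "v n * ((1 - q ^ (2 * n)) * w) + R n (Suc n) * q ^ (n * (2 * Suc n + 1))
      = w + q ^ ((n + 1) * (2 * n + 1))" .
  have "(\<Sum>s<Suc n. R s (Suc n) * q ^ (s * (2 * Suc n + 1)))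
      = (\<Sum>s<2 * n. q ^ triang s) + q ^ triang (2 * n) + q ^ triang (2 * n + 1)"
    unfolding sum.lessThan_Suc 1 triang_even triang_odd w_def[symmetric]
    by (simp only: 2 add.assoc)
  then show ?case unfolding R_def by simp
qed

section \<open>The logarithmic derivative of \<open>psi\<close>\<close>

definition psi :: "rat fps" where
  "psi = Abs_fps (\<lambda>m. of_nat (card {k. triang k = m}))"

text \<open>This is h of the outline. At \<open>m = 0\<close> the divisor set is infinite and the
  sum takes the default value 0, as the constant coefficient of a logarithmic derivative
  should.\<close>

definition altsigma :: "nat \<Rightarrow> int" where
  "altsigma m = (\<Sum>d | d dvd m. - ((-1) ^ d) * int d)"

text \<open>For \<open>k > 0\<close>, the expansion of k q^k / (1 - q^k), which is minus the
  logarithmic derivative of 1 - q^k with respect to the Euler operator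
  \<open>fps_X * fps_deriv\<close>.\<close>

definition lambert :: "nat \<Rightarrow> rat fps" where
  "lambert k = Abs_fps (\<lambda>m. if 0 < m \<and> k dvd m then of_nat k else 0)"

lemma lambert_mult:
  assumes "k > 0"
  shows "lambert k * (1 - fps_X ^ k) = of_nat k * fps_X ^ k"
proof (rule fps_ext)
  fix m
  have "fps_nth (lambert k * (1 - fps_X ^ k)) m
      = fps_nth (lambert k) m - (if m < k then 0 else fps_nth (lambert k) (m - k))"
    by (simp add: right_diff_distrib fps_X_power_mult_right_nth)
  also have "\<dots> = fps_nth (of_nat k * fps_X ^ k) m"
    using assms dvd_minus_self[of k m]
    by (auto simp: lambert_def fps_X_power_nth simp flip: fps_of_nat dest: dvd_imp_le)
  finally show "fps_nth (lambert k * (1 - fps_X ^ k)) m = fps_nth (of_nat k * fps_X ^ k) m" .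
qed


lemma theta_nth: "fps_nth (fps_X * fps_deriv f) m = of_nat m * fps_nth f m"
  by (cases m) auto

lemma theta_one_minus_power:
  assumes "k > 0"
  shows "fps_X * fps_deriv (1 - fps_X ^ k) = - (lambert k * (1 - fps_X ^ k))"
  unfolding lambert_mult[OF assms]
  by (rule fps_ext, unfold theta_nth) (use assms in \<open>auto simp: fps_X_power_nth simp flip: fps_of_nat\<close>)

lemma theta_quotient:
  fixes v :: "rat fps"
  assumes "v * (1 - fps_X ^ k) = 1" "k > 0" "l > 0"
  shows "fps_X * fps_deriv ((1 - fps_X ^ l) * v) = (1 - fps_X ^ l) * v * (lambert k - lambert l)"
proof -
  have leibniz: "fps_X * fps_deriv (f * g) = fps_X * fps_deriv f * g + f * (fps_X * fps_deriv g)"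
    for f g :: "rat fps"
    by (simp add: algebra_simps)
  have "fps_X * fps_deriv (v * (1 - fps_X ^ k)) = 0"
    unfolding assms(1) by simp
  then have "fps_X * fps_deriv v * (1 - fps_X ^ k) = v * (lambert k * (1 - fps_X ^ k))"
    unfolding leibniz theta_one_minus_power[OF assms(2)] by simp
  \<comment> \<open>Multiplying by \<open>v\<close> once more cancels the factor
    \<open>1 - fps_X ^ k\<close> on both sides.\<close>
  then have "fps_X * fps_deriv v * (1 - fps_X ^ k) * v = v * (lambert k * (1 - fps_X ^ k)) * v"
    by simp
  then have "fps_X * fps_deriv v * (v * (1 - fps_X ^ k)) = v * lambert k * (v * (1 - fps_X ^ k))"
    by (simp only: ac_simps)
  then have "fps_X * fps_deriv v = v * lambert k"
    unfolding assms(1) by simp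
  then show ?thesis
    unfolding leibniz theta_one_minus_power[OF assms(3)] by (simp add: algebra_simps)
qed

lemma theta_prod:
  fixes u l :: "nat \<Rightarrow> 'a::comm_ring_1 fps"
  assumes "\<And>i. fps_X * fps_deriv (u i) = u i * l i"
  shows "fps_X * fps_deriv (\<Prod>i<n. u i) = (\<Prod>i<n. u i) * (\<Sum>i<n. l i)"
proof (induction n)
  case (Suc n)
  have "fps_X * fps_deriv (\<Prod>i<Suc n. u i)
      = (fps_X * fps_deriv (\<Prod>i<n. u i)) * u n + (\<Prod>i<n. u i) * (fps_X * fps_deriv (u n))"
    by (simp add: algebra_simps)
  also have "\<dots> = (\<Prod>i<Suc n. u i) * (\<Sum>i<Suc n. l i)"
    unfolding Suc.IH assms by (simp add: algebra_simps)
  finally show ?case .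
qed simp

text \<open>For \<open>m > 0\<close> the indices 1, ..., 2n contain every divisor of
  \<open>m\<close>; odd ones enter with sign plus, even ones with minus. At \<open>m = 0\<close>
  both sides are 0.\<close>

lemma lambert_sum_nth:
  assumes "m \<le> 2 * n"
  shows "fps_nth (\<Sum>i<n. lambert (2 * i + 1) - lambert (2 * i + 2)) m = of_int (altsigma m)"
proof (cases "m = 0")
  case True
  then show ?thesis by (simp add: fps_sum_nth lambert_def altsigma_def)
next
  case False
  define g where "g d = - ((-1) ^ d) * fps_nth (lambert d) m" for d
  have "(\<Sum>i<k. g (2 * i + 1) + g (2 * i + 2)) = (\<Sum>d\<in>{1..2 * k}. g d)" for k
    by (induction k) (auto simp: algebra_simps)
  moreover have "fps_nth (\<Sum>i<n. lambert (2 * i + 1) - lambert (2 * i + 2)) m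
      = (\<Sum>i<n. g (2 * i + 1) + g (2 * i + 2))"
    unfolding g_def by (simp add: fps_sum_nth)
  ultimately have "fps_nth (\<Sum>i<n. lambert (2 * i + 1) - lambert (2 * i + 2)) m
      = (\<Sum>d\<in>{1..2 * n}. g d)" by simp
  also have "\<dots> = (\<Sum>d | d dvd m. g d)"
  proof (rule sum.mono_neutral_right)
    show "{d. d dvd m} \<subseteq> {1..2 * n}"
    proof
      fix d assume "d \<in> {d. d dvd m}"
      then show "d \<in> {1..2 * n}"
        using False assms dvd_imp_le[of d m] by (cases "d = 0") auto
    qed
  qed (auto simp: g_def lambert_def)
  also have "\<dots> = of_int (altsigma m)"
    unfolding altsigma_def of_int_sum using False
    by (intro sum.cong) (auto simp: g_def lambert_def)
  finally show ?thesis .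
qed

text \<open>Modulo \<open>q\<^sup>2\<^sup>n\<close> only the term \<open>s = 0\<close> of the left-hand side of Shanks' identity survives.\<close>
lemma psi_nth_eq_prod_nth:
  fixes v :: "nat \<Rightarrow> rat fps"
  assumes v: "\<And>i. v i * (1 - fps_X ^ (2 * i + 1)) = 1" and "m < 2 * n"
  shows "fps_nth psi m = fps_nth (\<Prod>i<n. (1 - fps_X ^ (2 * i + 2)) * v i) m"
proof -
  have "fps_nth (\<Sum>s<2 * n. fps_X ^ triang s) m = (\<Sum>s<2 * n. if triang s = m then 1 else 0 :: rat)"
    by (auto simp: fps_sum_nth fps_X_power_nth intro!: sum.cong)
  also have "\<dots> = of_nat (card {s \<in> {..<2 * n}. triang s = m})"
    by (simp add: sum.If_cases Int_def)
  also have "{s \<in> {..<2 * n}. triang s = m} = {s. triang s = m}"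
    using assms(2) le_triang order.strict_trans1 by auto
  finally have "fps_nth psi m = fps_nth (\<Sum>s<2 * n. fps_X ^ triang s) m"
    unfolding psi_def by simp
  also have "\<dots> = (\<Sum>s<n. fps_nth ((\<Prod>i=s..<n. (1 - fps_X ^ (2 * i + 2)) * v i) * fps_X ^ (s * (2 * n + 1))) m)"
    by (simp only: shanks_identity[OF v, symmetric] fps_sum_nth)
  also have "\<dots> = (\<Sum>s\<in>{0}. fps_nth ((\<Prod>i=s..<n. (1 - fps_X ^ (2 * i + 2)) * v i) * fps_X ^ (s * (2 * n + 1))) m)"
  proof (rule sum.mono_neutral_right)
    show "\<forall>s\<in>{..<n} - {0}. fps_nth ((\<Prod>i=s..<n. (1 - fps_X ^ (2 * i + 2)) * v i) * fps_X ^ (s * (2 * n + 1))) m = 0"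
    proof
      fix s assume "s \<in> {..<n} - {0}"
      then have "2 * n + 1 \<le> s * (2 * n + 1)" by (cases s) auto
      then have "m < s * (2 * n + 1)" using assms(2) by linarith
      then show "fps_nth ((\<Prod>i=s..<n. (1 - fps_X ^ (2 * i + 2)) * v i) * fps_X ^ (s * (2 * n + 1))) m = 0"
        unfolding fps_X_power_mult_right_nth by simp
    qed
  qed (use assms(2) in auto)
  finally show ?thesis by (simp add: atLeast0LessThan)
qed

text \<open>The infinite product is never formed: coefficient \<open>m\<close> on either side
  depends only on coefficients of \<open>psi\<close> up to \<open>m\<close>, and these agree with
  those of a finite product.\<close>

lemma theta_psi: "fps_X * fps_deriv psi = psi * Abs_fps (\<lambda>m. of_int (altsigma m))"
proof (rule fps_ext)
  fix m
  define v :: "nat \<Rightarrow> rat fps" where "v i = inverse (1 - fps_X ^ (2 * i + 1))" for i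
  have v: "v i * (1 - fps_X ^ (2 * i + 1)) = 1" for i
    unfolding v_def by (rule inverse_mult_eq_1) simp
  \<comment> \<open>\<open>Suc m\<close> factors are enough, since both coefficient lemmas ask only
    that twice the number of factors exceed or reach the index.\<close>
  define P where "P = (\<Prod>i<Suc m. (1 - fps_X ^ (2 * i + 2)) * v i)"
  have psi: "fps_nth psi i = fps_nth P i" if "i \<le> m" for i
    unfolding P_def using that by (intro psi_nth_eq_prod_nth v) auto
  have "fps_nth (fps_X * fps_deriv psi) m = fps_nth (fps_X * fps_deriv P) m"
    unfolding theta_nth by (simp add: psi)
  also have "fps_X * fps_deriv P = P * (\<Sum>i<Suc m. lambert (2 * i + 1) - lambert (2 * i + 2))"
    unfolding P_def by (intro theta_prod theta_quotient v) auto
  also have "fps_nth \<dots> m = (\<Sum>i=0..m. fps_nth P i * of_int (altsigma (m - i)))"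
    unfolding fps_mult_nth by (intro sum.cong refl arg_cong2[where f = "(*)"] lambert_sum_nth) auto
  also have "\<dots> = fps_nth (psi * Abs_fps (\<lambda>m. of_int (altsigma m))) m"
    unfolding fps_mult_nth by (intro sum.cong) (auto simp: psi)
  finally show "fps_nth (fps_X * fps_deriv psi) m
      = fps_nth (psi * Abs_fps (\<lambda>m. of_int (altsigma m))) m" .
qed

section \<open>\<open>psi ^ 4\<close> as the generating function of \<open>t4\<close>\<close>

text \<open>The fibre of a sum splits by the value of \<open>f\<close>, which turns its size into a
  convolution. The finiteness claim allows a second application, to pairs of pairs.\<close>

lemma fiber_gf_mult:
  fixes f :: "'a \<Rightarrow> nat" and g :: "'b \<Rightarrow> nat"
  assumes f: "\<And>m. finite {x. f x = m}" and g: "\<And>m. finite {y. g y = m}"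
  shows "Abs_fps (\<lambda>m. of_nat (card {x. f x = m})) * Abs_fps (\<lambda>m. of_nat (card {y. g y = m}))
       = (Abs_fps (\<lambda>m. of_nat (card {(x, y). f x + g y = m})) :: 'c::comm_semiring_1 fps)"
    and "finite {(x, y). f x + g y = m}"
proof -
  have eq: "{(x, y). f x + g y = m} = (\<Union>i\<in>{0..m}. {x. f x = i} \<times> {y. g y = m - i})" for m
    by auto
  show "finite {(x, y). f x + g y = m}"
    unfolding eq using f g by blast
  have "card {(x, y). f x + g y = m} = (\<Sum>i\<in>{0..m}. card ({x. f x = i} \<times> {y. g y = m - i}))" for m
    unfolding eq using f g by (intro card_UN_disjoint) auto
  then show "Abs_fps (\<lambda>m. of_nat (card {x. f x = m})) * Abs_fps (\<lambda>m. of_nat (card {y. g y = m}))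
       = (Abs_fps (\<lambda>m. of_nat (card {(x, y). f x + g y = m})) :: 'c fps)"
    by (intro fps_ext) (simp add: fps_mult_nth card_cartesian_product)
qed

lemma finite_triang: "finite {k. triang k = m}"
  by (rule finite_subset[of _ "{..m}"]) (use le_triang in auto)

lemma psi_power4_nth: "fps_nth (psi ^ 4) m = of_nat (t4 m)"
proof -
  define f2 where "f2 = (\<lambda>(x, y). triang x + triang y)"
  have "psi * psi = Abs_fps (\<lambda>m. of_nat (card {p. f2 p = m}))"
    unfolding psi_def fiber_gf_mult(1)[OF finite_triang finite_triang]
    by (simp add: f2_def case_prod_beta')
  moreover have fin: "finite {p. f2 p = m}" for m
    using fiber_gf_mult(2)[OF finite_triang finite_triang, of m] by (simp add: f2_def case_prod_beta')
  ultimately have "(psi * psi) * (psi * psi) = Abs_fps (\<lambda>m. of_nat (card {(p, p'). f2 p + f2 p' = m}))"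
    by (simp add: fiber_gf_mult(1)[OF fin fin])
  moreover have "psi ^ 4 = (psi * psi) * (psi * psi)"
    by (simp add: numeral_eq_Suc mult.assoc)
  moreover have "card {(p, p'). f2 p + f2 p' = m} = t4 m"
    unfolding t4_def
    by (rule bij_betw_same_card[of "\<lambda>((a, b), (c, d)). (a, b, c, d)"],
        rule bij_betw_byWitness[of _ "\<lambda>(a, b, c, d). ((a, b), (c, d))"])
      (auto simp: f2_def triang_def)
  ultimately show ?thesis by simp
qed

lemma t4_recurrence:
  "of_nat (n * t4 n) = 4 * (\<Sum>j<n. of_nat (t4 j) * of_int (altsigma (n - j)) :: rat)"
proof -
  define H :: "rat fps" where "H = Abs_fps (\<lambda>m. of_int (altsigma m))"
  have "fps_X * fps_deriv (psi ^ 4) = 4 * psi ^ 3 * (fps_X * fps_deriv psi)"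
    by (simp add: fps_deriv_power numeral_eq_Suc algebra_simps)
  also have "\<dots> = 4 * (psi ^ 4 * H)"
    unfolding theta_psi H_def by (simp add: numeral_eq_Suc algebra_simps)
  also have "\<dots> = fps_const 4 * (psi ^ 4 * H)"
    by (simp add: numeral_fps_const)
  finally have "of_nat n * fps_nth (psi ^ 4) n = 4 * fps_nth (psi ^ 4 * H) n"
    by (metis theta_nth fps_mult_left_const_nth)
  also have "\<dots> = 4 * (\<Sum>j=0..n. of_nat (t4 j) * of_int (altsigma (n - j)))"
    by (simp add: fps_mult_nth psi_power4_nth H_def)
  \<comment> \<open>The term \<open>j = n\<close> drops out because
    \<open>altsigma 0 = 0\<close>.\<close>
  also have "(\<Sum>j=0..n. of_nat (t4 j) * of_int (altsigma (n - j)) :: rat)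
      = (\<Sum>j<n. of_nat (t4 j) * of_int (altsigma (n - j)))"
    by (simp add: atLeast0AtMost altsigma_def flip: lessThan_Suc_atMost)
  finally show ?thesis by (simp add: psi_power4_nth)
qed

subsection \<open>Liouville sums\<close>

definition quads :: "nat \<Rightarrow> (nat \<times> nat \<times> nat \<times> nat) set" where
  "quads N = {(x, y, d, e). 0 < x \<and> 0 < y \<and> 0 < d \<and> 0 < e \<and> x * y + d * e = N}"

lemma finite_quads [simp]: "finite (quads N)"
proof (rule finite_subset)
  show "quads N \<subseteq> {..N} \<times> {..N} \<times> {..N} \<times> {..N}"
  proof (clarsimp simp: quads_def)
    fix x y d e :: nat
    assume "0 < x" "0 < y" "0 < d" "0 < e"
    then have "x \<le> x * y" "y \<le> x * y" "d \<le> d * e" "e \<le> d * e" by auto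
    then show "x \<le> x * y + d * e \<and> y \<le> x * y + d * e \<and> d \<le> x * y + d * e \<and> e \<le> x * y + d * e"
      by linarith
  qed
qed simp

lemma sum_quads_swap:
  "(\<Sum>(x, y, d, e) | (x, y, d, e) \<in> quads N \<and> P x y d e. F x y d e)
   = (\<Sum>(x, y, d, e) | (x, y, d, e) \<in> quads N \<and> P d e x y. F d e x y)"
  by (rule sum.reindex_bij_witness[where i = "\<lambda>(x, y, d, e). (d, e, x, y)"
        and j = "\<lambda>(x, y, d, e). (d, e, x, y)"])
     (auto simp: quads_def add.commute)

text \<open>The substitution \<open>x y + d e = (x - d) y + d (e + y)\<close>.\<close>
lemma sum_quads_shift:
  "(\<Sum>(x, y, d, e) | (x, y, d, e) \<in> quads N \<and> d < x. F x y d e)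
   = (\<Sum>(x, y, d, e) | (x, y, d, e) \<in> quads N \<and> y < e. F (x + d) y d (e - y))"
proof (rule sum.reindex_bij_witness[where j = "\<lambda>(x, y, d, e). (x - d, y, d, e + y)"
        and i = "\<lambda>(x, y, d, e). (x + d, y, d, e - y)"], goal_cases)
  case (2 z)
  then show ?case by (auto simp: quads_def algebra_simps dest!: less_imp_Suc_add)
next
  case (4 z)
  then show ?case by (auto simp: quads_def algebra_simps dest!: less_imp_Suc_add)
qed auto

text \<open>For fixed \<open>x\<close> and \<open>e\<close>, the solutions \<open>(y, d)\<close> lie on lines of direction \<open>(e, -x)\<close>,
  and each line that meets the positive quadrant has exactly one point with \<open>d \<le> x\<close> and exactly
  one point with \<open>y \<le> e\<close>.\<close>
lemma sum_quads_exchange: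
  "(\<Sum>(x, y, d, e) | (x, y, d, e) \<in> quads N \<and> d \<le> x. F x e)
   = (\<Sum>(x, y, d, e) | (x, y, d, e) \<in> quads N \<and> y \<le> e. F x e)"
proof -
  have red: "\<exists>k r. y = e * k + Suc r \<and> r < e" if "0 < y" "0 < e" for y e :: nat
    using that by (intro exI[of _ "(y - 1) div e"] exI[of _ "(y - 1) mod e"]) simp
  show ?thesis
  \<comment> \<open>Lowering \<open>y\<close> by \<open>e\<close> and raising \<open>d\<close> by
    \<open>x\<close> preserves \<open>x * y + d * e\<close>. The shift by one makes residues run
    from 1 to \<open>e\<close> (or \<open>x\<close>), so that they stay positive.\<close>
  proof (rule sum.reindex_bij_witness[
        where j = "\<lambda>(x, y, d, e). (x, Suc ((y - 1) mod e), d + ((y - 1) div e) * x, e)"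
        and i = "\<lambda>(x, y, d, e). (x, y + ((d - 1) div x) * e, Suc ((d - 1) mod x), e)"], goal_cases)
    case (1 z)
    obtain x y d e where z: "z = (x, y, d, e)" by (cases z)
    with 1 have h: "0 < x" "0 < y" "0 < d" "0 < e" "d \<le> x" by (auto simp: quads_def)
    with red[of y e] obtain k r where "y = e * k + Suc r" "r < e" by blast
    moreover from h obtain t where "d = Suc t" "t < x" by (cases d) auto
    ultimately show ?case using h z by (auto simp: mult.commute)
  next
    case (2 z)
    obtain x y d e where z: "z = (x, y, d, e)" by (cases z)
    with 2 have h: "0 < x" "0 < y" "0 < d" "0 < e" "x * y + d * e = N" by (auto simp: quads_def)
    with red[of y e] obtain k r where "y = e * k + Suc r" "r < e" by blast
    with h z show ?case by (auto simp: quads_def algebra_simps)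
  next
    case (3 z)
    obtain x y d e where z: "z = (x, y, d, e)" by (cases z)
    with 3 have h: "0 < x" "0 < y" "0 < d" "0 < e" "y \<le> e" by (auto simp: quads_def)
    with red[of d x] obtain k r where "d = x * k + Suc r" "r < x" by blast
    moreover from h obtain t where "y = Suc t" "t < e" by (cases y) auto
    ultimately show ?case using h z by (auto simp: mult.commute)
  next
    case (4 z)
    obtain x y d e where z: "z = (x, y, d, e)" by (cases z)
    with 4 have h: "0 < x" "0 < y" "0 < d" "0 < e" "x * y + d * e = N" by (auto simp: quads_def)
    with red[of d x] obtain k r where "d = x * k + Suc r" "r < x" by blast
    with h z show ?case by (auto simp: quads_def algebra_simps)
  qed auto
qed

lemma sum_quads_split:
  fixes F :: "nat \<Rightarrow> nat \<Rightarrow> nat \<Rightarrow> nat \<Rightarrow> 'a::comm_monoid_add"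
  assumes "\<And>x y d e. P x y d e \<Longrightarrow> Q x y d e \<Longrightarrow> False"
  shows "(\<Sum>(x, y, d, e) | (x, y, d, e) \<in> quads N \<and> (P x y d e \<or> Q x y d e). F x y d e)
   = (\<Sum>(x, y, d, e) | (x, y, d, e) \<in> quads N \<and> P x y d e. F x y d e)
   + (\<Sum>(x, y, d, e) | (x, y, d, e) \<in> quads N \<and> Q x y d e. F x y d e)"
proof -
  have fin: "finite {(x, y, d, e). (x, y, d, e) \<in> quads N \<and> R x y d e}" for R
    by (rule finite_subset[OF _ finite_quads[of N]]) auto
  show ?thesis
    by (subst sum.union_disjoint[symmetric])
      (use assms fin in \<open>auto intro!: sum.cong\<close>)
qed

text \<open>On this diagonal the equation reads x (y + e) = N: \<open>x\<close> is a divisor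
  \<open>u\<close>, and \<open>y\<close> is free below \<open>N div u\<close>.\<close>

lemma sum_quads_diag_left:
  assumes "0 < N"
  shows "(\<Sum>(x, y, d, e) | (x, y, d, e) \<in> quads N \<and> d = x. F x)
       = (\<Sum>u | u dvd N. \<Sum>y\<in>{1..<N div u}. F u)"
proof -
  have "(\<Sum>(x, y, d, e) | (x, y, d, e) \<in> quads N \<and> d = x. F x)
     = (\<Sum>(u, y)\<in>(SIGMA u:{u. u dvd N}. {1..<N div u}). F u)"
  proof (rule sum.reindex_bij_witness[where j = "\<lambda>(x, y, d, e). (x, y)"
        and i = "\<lambda>(u, y). (u, y, u, N div u - y)"], goal_cases)
    case (1 z)
    obtain x y d e where z: "z = (x, y, d, e)" by (cases z)
    with 1 have h: "0 < x" "0 < y" "0 < e" "d = x" "N = x * (y + e)"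
      by (auto simp: quads_def algebra_simps)
    then show ?case using z by simp
  next
    case (2 z)
    obtain x y d e where z: "z = (x, y, d, e)" by (cases z)
    with 2 have h: "0 < x" "0 < y" "0 < e" "d = x" "N = x * (y + e)"
      by (auto simp: quads_def algebra_simps)
    then show ?case using z by simp
  next
    case (4 z)
    then show ?case using assms
      by (auto simp: quads_def dvd_def simp flip: add_mult_distrib2 intro: Nat.gr0I)
  qed auto
  also have "\<dots> = (\<Sum>u | u dvd N. \<Sum>y\<in>{1..<N div u}. F u)"
    using assms by (subst sum.Sigma) auto
  finally show ?thesis .
qed

text \<open>On this diagonal the equation reads (x + d) e = N: \<open>x + d\<close> is a divisor
  \<open>c\<close>, and \<open>x\<close> is free below \<open>c\<close>.\<close>

lemma sum_quads_diag_right: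
  assumes "0 < N"
  shows "(\<Sum>(x, y, d, e) | (x, y, d, e) \<in> quads N \<and> y = e. F x d)
       = (\<Sum>c | c dvd N. \<Sum>u\<in>{1..<c}. F u (c - u))"
proof -
  have "(\<Sum>(x, y, d, e) | (x, y, d, e) \<in> quads N \<and> y = e. F x d)
     = (\<Sum>(c, u)\<in>(SIGMA c:{c. c dvd N}. {1..<c}). F u (c - u))"
  proof (rule sum.reindex_bij_witness[where j = "\<lambda>(x, y, d, e). (x + d, x)"
        and i = "\<lambda>(c, u). (u, N div c, c - u, N div c)"], goal_cases)
    case (1 z)
    obtain x y d e where z: "z = (x, y, d, e)" by (cases z)
    with 1 have h: "0 < x" "0 < d" "0 < e" "y = e" "N = (x + d) * e"
      by (auto simp: quads_def algebra_simps)
    then show ?case using z by simp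
  next
    case (2 z)
    obtain x y d e where z: "z = (x, y, d, e)" by (cases z)
    with 2 have h: "0 < x" "0 < d" "0 < e" "y = e" "N = (x + d) * e"
      by (auto simp: quads_def algebra_simps)
    then show ?case using z by simp
  next
    case (4 z)
    then show ?case using assms
      by (auto simp: quads_def dvd_def simp flip: add_mult_distrib intro: Nat.gr0I)
  qed auto
  also have "\<dots> = (\<Sum>c | c dvd N. \<Sum>u\<in>{1..<c}. F u (c - u))"
    using assms by (subst sum.Sigma) auto
  finally show ?thesis .
qed


text \<open>Swapping and shifting reduce both sums to sums of f(x): the differences give twice the
  sum over \<open>y < e\<close>, the sums x + d give twice the sum over \<open>d < x\<close> plus a
  diagonal. The exchange lemma compares these two regions up to their diagonals, and the diagonals
  are divisor sums.\<close>

lemma liouville_identity: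
  fixes f :: "int \<Rightarrow> int"
  assumes even: "\<And>t. f (- t) = f t" and f0: "f 0 = 0" and N: "0 < N"
  shows "(\<Sum>(x, y, d, e)\<in>quads N. f (int x - int d) - f (int x + int d))
    = 2 * (\<Sum>u | u dvd N. (int (N div u) - 1) * f (int u))
      - 2 * (\<Sum>c | c dvd N. \<Sum>u\<in>{1..<c}. f (int u))
      - (\<Sum>c | c dvd N. (int c - 1) * f (int c))"
proof -
  define S where "S P F = (\<Sum>(x, y, d, e) | (x, y, d, e) \<in> quads N \<and> P x y d e. F x y d e)"
    for P and F :: "nat \<Rightarrow> nat \<Rightarrow> nat \<Rightarrow> nat \<Rightarrow> int"
  have swap: "S P F = S (\<lambda>x y d e. P d e x y) (\<lambda>x y d e. F d e x y)" for P F
    unfolding S_def by (rule sum_quads_swap)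
  have shift: "S (\<lambda>x y d e. d < x) F = S (\<lambda>x y d e. y < e) (\<lambda>x y d e. F (x + d) y d (e - y))" for F
    unfolding S_def by (rule sum_quads_shift)
  have split: "S (\<lambda>x y d e. P x y d e \<or> Q x y d e) F = S P F + S Q F"
    if "\<And>x y d e. P x y d e \<Longrightarrow> Q x y d e \<Longrightarrow> False" for P Q F
    unfolding S_def using that by (rule sum_quads_split)
  have all: "(\<Sum>(x, y, d, e)\<in>quads N. F x y d e) = S P F" if "\<And>x y d e. P x y d e" for P F
    unfolding S_def using that by (auto intro!: sum.cong)
  have exch: "S (\<lambda>x y d e. d \<le> x) (\<lambda>x y d e. f (int x)) = S (\<lambda>x y d e. y \<le> e) (\<lambda>x y d e. f (int x))"
    unfolding S_def by (rule sum_quads_exchange)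
  have cong: "S P F = S Q G" if "\<And>x y d e. P x y d e \<longleftrightarrow> Q x y d e"
    "\<And>x y d e. Q x y d e \<Longrightarrow> F x y d e = G x y d e" for P Q F G
    unfolding S_def using that by (auto intro!: sum.cong)

  have even_diff: "f (a - b) = f (b - a)" for a b
    using even[of "b - a"] by simp
  have "(\<Sum>(x, y, d, e)\<in>quads N. f (int x - int d))
      = S (\<lambda>x y d e. (d < x \<or> x < d) \<or> d = x) (\<lambda>x y d e. f (int x - int d))"
    by (rule all) auto
  also have "\<dots> = S (\<lambda>x y d e. d < x) (\<lambda>x y d e. f (int x - int d))
      + S (\<lambda>x y d e. x < d) (\<lambda>x y d e. f (int x - int d))
      + S (\<lambda>x y d e. d = x) (\<lambda>x y d e. f (int x - int d))"
    by (subst split, force, subst split) auto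
  also have "S (\<lambda>x y d e. d = x) (\<lambda>x y d e. f (int x - int d)) = 0"
    unfolding S_def by (rule sum.neutral) (auto simp: f0)
  also have "S (\<lambda>x y d e. x < d) (\<lambda>x y d e. f (int x - int d))
      = S (\<lambda>x y d e. d < x) (\<lambda>x y d e. f (int x - int d))"
    by (subst swap, rule cong) (auto intro: even_diff)
  \<comment> \<open>The shift replaces \<open>x\<close> by \<open>x + d\<close>, so the argument x -
    d becomes x.\<close>
  also have "S (\<lambda>x y d e. d < x) (\<lambda>x y d e. f (int x - int d)) = S (\<lambda>x y d e. y < e) (\<lambda>x y d e. f (int x))"
    by (subst shift, rule cong) auto
  finally have 1: "(\<Sum>(x, y, d, e)\<in>quads N. f (int x - int d))
      = 2 * S (\<lambda>x y d e. y < e) (\<lambda>x y d e. f (int x))" by simp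

  have "(\<Sum>(x, y, d, e)\<in>quads N. f (int x + int d))
      = S (\<lambda>x y d e. (y < e \<or> e < y) \<or> y = e) (\<lambda>x y d e. f (int x + int d))"
    by (rule all) auto
  also have "\<dots> = S (\<lambda>x y d e. y < e) (\<lambda>x y d e. f (int x + int d))
      + S (\<lambda>x y d e. e < y) (\<lambda>x y d e. f (int x + int d))
      + S (\<lambda>x y d e. y = e) (\<lambda>x y d e. f (int x + int d))"
    by (subst split, force, subst split) auto
  also have "S (\<lambda>x y d e. e < y) (\<lambda>x y d e. f (int x + int d))
      = S (\<lambda>x y d e. y < e) (\<lambda>x y d e. f (int x + int d))"
    by (subst swap, rule cong) (auto simp: add.commute)
  also have "S (\<lambda>x y d e. y < e) (\<lambda>x y d e. f (int x + int d)) = S (\<lambda>x y d e. d < x) (\<lambda>x y d e. f (int x))"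
    by (subst shift, rule cong) auto
  also have "S (\<lambda>x y d e. y = e) (\<lambda>x y d e. f (int x + int d))
      = (\<Sum>c | c dvd N. \<Sum>u\<in>{1..<c}. f (int u + int (c - u)))"
    unfolding S_def by (rule sum_quads_diag_right[OF N])
  also have "\<dots> = (\<Sum>c | c dvd N. (int c - 1) * f (int c))"
  proof (rule sum.cong[OF refl])
    fix c assume "c \<in> {c. c dvd N}"
    then have "0 < c" using N by (auto intro: Nat.gr0I)
    moreover have "(\<Sum>u\<in>{1..<c}. f (int u + int (c - u))) = (\<Sum>u\<in>{1..<c}. f (int c))"
      by (rule sum.cong) auto
    ultimately show "(\<Sum>u\<in>{1..<c}. f (int u + int (c - u))) = (int c - 1) * f (int c)"
      by (simp add: of_nat_diff)
  qed
  finally have 2: "(\<Sum>(x, y, d, e)\<in>quads N. f (int x + int d))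
      = 2 * S (\<lambda>x y d e. d < x) (\<lambda>x y d e. f (int x)) + (\<Sum>c | c dvd N. (int c - 1) * f (int c))"
    by simp

  \<comment> \<open>The exchange holds for the weak inequalities; splitting off the diagonals
    relates the strict regions.\<close>
  have "S (\<lambda>x y d e. d < x) (\<lambda>x y d e. f (int x)) + S (\<lambda>x y d e. d = x) (\<lambda>x y d e. f (int x))
      = S (\<lambda>x y d e. y < e) (\<lambda>x y d e. f (int x)) + S (\<lambda>x y d e. y = e) (\<lambda>x y d e. f (int x))"
    using exch unfolding le_less by (subst (asm) split, force, subst (asm) split) auto
  moreover have "S (\<lambda>x y d e. y = e) (\<lambda>x y d e. f (int x)) = (\<Sum>c | c dvd N. \<Sum>u\<in>{1..<c}. f (int u))"
    unfolding S_def by (rule sum_quads_diag_right[OF N])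
  moreover have "S (\<lambda>x y d e. d = x) (\<lambda>x y d e. f (int x))
      = (\<Sum>u | u dvd N. (int (N div u) - 1) * f (int u))"
  proof -
    have "0 < N div u" if "u dvd N" for u
      using that N by (auto simp: dvd_div_eq_0_iff intro!: Nat.gr0I)
    then show ?thesis
      unfolding S_def sum_quads_diag_left[OF N] by (intro sum.cong) (auto simp: of_nat_diff Suc_le_eq)
  qed
  moreover have "(\<Sum>(x, y, d, e)\<in>quads N. f (int x - int d) - f (int x + int d))
      = (\<Sum>(x, y, d, e)\<in>quads N. f (int x - int d)) - (\<Sum>(x, y, d, e)\<in>quads N. f (int x + int d))"
    by (simp add: sum_subtractf case_prod_beta')
  ultimately show ?thesis
    unfolding 1 2 by simp
qed

text \<open>The weights \<open>-4\<close> and \<open>1\<close> are chosen so that all terms \<open>\<sigma>\<^sub>2\<close> and \<open>\<sigma>\<^sub>3\<close> cancel in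
  Liouville's identity.\<close>
definition signed_square :: "int \<Rightarrow> int" where
  "signed_square t = (if even t then - 4 * t\<^sup>2 else t\<^sup>2)"

text \<open>The upper bound has the form \<open>2 * k + 1\<close> because it will be a divisor of an
  odd number; each induction step adds one odd and one even square.\<close>

lemma sum_signed_square:
  "2 * (\<Sum>u\<in>{1..<2 * k + 1}. signed_square (int u)) = - ((2 * int k) * (2 * int k + 1) * (2 * int k + 3))"
proof (induction k)
  case (Suc k)
  have "{1..<2 * Suc k + 1} = insert (2 * k + 2) (insert (2 * k + 1) {1..<2 * k + 1})" by auto
  then show ?case using Suc.IH
    by (simp add: signed_square_def algebra_simps power2_eq_square)
qed (simp add: signed_square_def)

text \<open>x - d and x + d have equal parity and their squares differ by -4xd, so the weights -4
  and 1 become 16 and -4.\<close>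

lemma liouville_signed_square:
  fixes n :: nat
  defines "N \<equiv> 2 * n + 1"
  shows "(\<Sum>(x, y, d, e)\<in>quads N. (if even (x + d) then 16 else - 4) * (int x * int d))
       = 4 * int n * int (\<Sum>{d. d dvd N})"
proof -
  have "(\<Sum>(x, y, d, e)\<in>quads N. (if even (x + d) then 16 else - 4) * (int x * int d))
      = (\<Sum>(x, y, d, e)\<in>quads N. signed_square (int x - int d) - signed_square (int x + int d))"
    by (intro sum.cong) (auto simp: signed_square_def algebra_simps power2_eq_square)
  also have "\<dots> = 2 * (\<Sum>u | u dvd N. (int (N div u) - 1) * signed_square (int u))
      - 2 * (\<Sum>c | c dvd N. \<Sum>u\<in>{1..<c}. signed_square (int u))
      - (\<Sum>c | c dvd N. (int c - 1) * signed_square (int c))"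
    by (rule liouville_identity) (auto simp: signed_square_def N_def)
  also have "\<dots> = (\<Sum>c | c dvd N. 2 * ((int (N div c) - 1) * signed_square (int c))
      - 2 * (\<Sum>u\<in>{1..<c}. signed_square (int u)) - (int c - 1) * signed_square (int c))"
    by (simp add: sum_subtractf sum_distrib_left)
  also have "\<dots> = (\<Sum>c | c dvd N. 4 * int n * int c)"
  proof (rule sum.cong[OF refl])
    fix c assume "c \<in> {c. c dvd N}"
    then have c: "c dvd N" by simp
    moreover have "odd N" unfolding N_def by simp
    ultimately have "odd c" using dvd_trans by blast
    then obtain k where k: "c = 2 * k + 1" by (elim oddE)
    obtain b where b: "N = c * b" using c by (elim dvdE)
    have "N div c = b" unfolding b by (rule nonzero_mult_div_cancel_left) (use k in simp)
    have sq: "signed_square (int c) = (int c)\<^sup>2" using \<open>odd c\<close> by (simp add: signed_square_def)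
    have "2 * (\<Sum>u\<in>{1..<c}. signed_square (int u)) = - ((int c - 1) * int c * (int c + 2))"
      unfolding k using sum_signed_square[of k] by (simp add: algebra_simps)
    \<comment> \<open>The first term contributes 2bc^2 - 2c^2, the other two together 2c^2 - 2c;
      what remains is 2c(bc - 1), and bc = N.\<close>
    then have "2 * ((int (N div c) - 1) * signed_square (int c))
      - 2 * (\<Sum>u\<in>{1..<c}. signed_square (int u)) - (int c - 1) * signed_square (int c)
      = 2 * (int c * int b - 1) * int c"
      unfolding sq \<open>N div c = b\<close> by (simp add: algebra_simps power2_eq_square)
    also have "int c * int b = 2 * int n + 1"
      using b unfolding N_def by (metis of_nat_mult of_nat_add of_nat_numeral of_nat_1)
    finally show "2 * ((int (N div c) - 1) * signed_square (int c))
      - 2 * (\<Sum>u\<in>{1..<c}. signed_square (int u)) - (int c - 1) * signed_square (int c)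
      = 4 * int n * int c" by simp
  qed
  finally show ?thesis by (simp add: sum_distrib_left)
qed

section \<open>The recurrence for divisor sums of odd numbers\<close>

text \<open>The divisors of 2b are the odd divisors of b and the doubles of all divisors of b. So a
  divisor d of b contributes 16d - 8d if odd and -8d if even.\<close>

lemma sum_divisors_double:
  assumes "0 < b"
  shows "(\<Sum>d | d dvd 2 * b. (if even d then - 4 else 16) * int d) = 8 * altsigma b"
proof -
  have fin: "finite {d. d dvd b \<and> odd d}" "finite ((*) 2 ` {d. d dvd b})"
    using assms by auto
  have eq: "{d. d dvd 2 * b} = {d. d dvd b \<and> odd d} \<union> (*) 2 ` {d. d dvd b}"
  proof (intro equalityI subsetI)
    fix d assume d: "d \<in> {d. d dvd 2 * b}"
    show "d \<in> {d. d dvd b \<and> odd d} \<union> (*) 2 ` {d. d dvd b}"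
    proof (cases "even d")
      case True
      then show ?thesis using d by (auto elim!: evenE)
    next
      case False
      then have "coprime d 2" by simp
      then show ?thesis using d False by (auto simp: coprime_dvd_mult_right_iff)
    qed
  qed auto
  have "(\<Sum>d | d dvd 2 * b. (if even d then - 4 else 16) * int d)
      = (\<Sum>d | d dvd b \<and> odd d. (if even d then - 4 else 16) * int d)
      + (\<Sum>d\<in>(*) 2 ` {d. d dvd b}. (if even d then - 4 else 16) * int d)"
    unfolding eq by (rule sum.union_disjoint[OF fin]) auto
  also have "(\<Sum>d | d dvd b \<and> odd d. (if even d then - 4 else 16) * int d)
      = (\<Sum>d | d dvd b. if odd d then 16 * int d else 0)"
    using assms by (intro sum.mono_neutral_cong_left) auto
  also have "(\<Sum>d\<in>(*) 2 ` {d. d dvd b}. (if even d then - 4 else 16) * int d)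
      = (\<Sum>d | d dvd b. - 8 * int d)"
    by (subst sum.reindex) (auto simp: inj_on_def)
  finally show ?thesis
    unfolding altsigma_def sum_distrib_left sum.distrib[symmetric] by (auto intro!: sum.cong)
qed

text \<open>As \<open>N\<close> is odd, exactly one of \<open>x y\<close> and \<open>d e\<close> is odd, and the summand is symmetric
  under exchanging the two products.\<close>
lemma sigma_odd_recurrence:
  "int n * int (\<Sum>{d. d dvd 2 * n + 1})
   = 4 * (\<Sum>j<n. int (\<Sum>{d. d dvd 2 * j + 1}) * altsigma (n - j))"
proof -
  define N where "N = 2 * n + 1"
  define F where "F x d = (if even (x + d) then 16 else - 4) * (int x * int d)" for x d
  have "(\<Sum>(x, y, d, e)\<in>quads N. F x d)
      = (\<Sum>(x, y, d, e) | (x, y, d, e) \<in> quads N \<and> (odd (x * y) \<or> odd (d * e)). F x d)"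
  proof (rule sum.cong)
    have "odd (x * y) \<or> odd (d * e)" if "(x, y, d, e) \<in> quads N" for x y d e
    proof -
      have "odd (x * y + d * e)" using that by (simp add: quads_def N_def)
      then show ?thesis by (metis even_add)
    qed
    then show "quads N = {(x, y, d, e). (x, y, d, e) \<in> quads N \<and> (odd (x * y) \<or> odd (d * e))}"
      by blast
  qed auto
  also have "\<dots> = (\<Sum>(x, y, d, e) | (x, y, d, e) \<in> quads N \<and> odd (x * y) \<and> even (d * e). F x d)
      + (\<Sum>(x, y, d, e) | (x, y, d, e) \<in> quads N \<and> odd (d * e) \<and> even (x * y). F x d)"
  proof (subst sum_quads_split[symmetric], blast, rule sum.cong)
    have "odd (x * y) = even (d * e)" if "(x, y, d, e) \<in> quads N" for x y d e
    proof -
      have "odd (x * y + d * e)" using that by (simp add: quads_def N_def)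
      then show ?thesis by (metis even_add)
    qed
    then show "{(x, y, d, e). (x, y, d, e) \<in> quads N \<and> (odd (x * y) \<or> odd (d * e))}
      = {(x, y, d, e). (x, y, d, e) \<in> quads N \<and> (odd (x * y) \<and> even (d * e) \<or> odd (d * e) \<and> even (x * y))}"
      by blast
  qed auto
  also have "(\<Sum>(x, y, d, e) | (x, y, d, e) \<in> quads N \<and> odd (d * e) \<and> even (x * y). F x d)
      = (\<Sum>(x, y, d, e) | (x, y, d, e) \<in> quads N \<and> odd (x * y) \<and> even (d * e). F x d)"
    by (subst sum_quads_swap) (auto simp: F_def add.commute mult.commute intro!: sum.cong)
  \<comment> \<open>Writing xy = 2j + 1 forces de = 2(n - j), with \<open>j < n\<close> because de
    is positive; \<open>x\<close> and \<open>d\<close> then determine their cofactors.\<close>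
  also have "(\<Sum>(x, y, d, e) | (x, y, d, e) \<in> quads N \<and> odd (x * y) \<and> even (d * e). F x d)
      = (\<Sum>(j, x, d)\<in>(SIGMA j:{..<n}. {x. x dvd 2 * j + 1} \<times> {d. d dvd 2 * (n - j)}). F x d)"
  proof (rule sum.reindex_bij_witness[where j = "\<lambda>(x, y, d, e). ((x * y) div 2, x, d)"
        and i = "\<lambda>(j, x, d). (x, (2 * j + 1) div x, d, (2 * (n - j)) div d)"], goal_cases)
    case (1 z)
    obtain x y d e where z: "z = (x, y, d, e)" by (cases z)
    with 1 have h: "0 < x" "0 < y" "0 < d" "0 < e" "x * y + d * e = 2 * n + 1" "odd (x * y)"
      by (auto simp: quads_def N_def)
    obtain j where j: "x * y = 2 * j + 1" using h(6) by (rule oddE)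
    then have "2 * (n - j) = d * e" using h(5) by simp
    then have "2 * (n - j) div d = e" using h(3) by simp
    moreover have "(2 * j + 1) div x = y" unfolding j[symmetric] using h(1) by simp
    moreover have "x * y div 2 = j" unfolding j by simp
    ultimately show ?case unfolding z by simp
  next
    case (2 z)
    obtain x y d e where z: "z = (x, y, d, e)" by (cases z)
    with 2 have h: "0 < x" "0 < y" "0 < d" "0 < e" "x * y + d * e = 2 * n + 1" "odd (x * y)"
      by (auto simp: quads_def N_def)
    obtain j where j: "x * y = 2 * j + 1" using h(6) by (rule oddE)
    then have de: "2 * (n - j) = d * e" using h(5) by simp
    then have "2 * (n - j) div d = e" using h(3) by simp
    moreover have "(2 * j + 1) div x = y" unfolding j[symmetric] using h(1) by simp
    moreover have "x * y div 2 = j" unfolding j by simp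
    moreover have "j < n"
    proof -
      have "0 < d * e" using h by simp
      then show ?thesis using h(5) j by linarith
    qed
    moreover have "x dvd 2 * j + 1" "d dvd 2 * (n - j)"
      unfolding j[symmetric] de by simp_all
    ultimately show ?case unfolding z by simp
  next
    case (3 z)
    then show ?case by auto
  next
    case (4 z)
    obtain j x d where z: "z = (j, x, d)" by (cases z)
    with 4 have h: "j < n" "x dvd 2 * j + 1" "d dvd 2 * (n - j)" by auto
    then obtain y e where ye: "2 * j + 1 = x * y" "2 * (n - j) = d * e" by (auto elim!: dvdE)
    have "0 < x * y" "0 < d * e" using h(1) by (simp_all flip: ye)
    then have pos: "0 < x" "0 < y" "0 < d" "0 < e" by auto
    have "x * y + d * e = 2 * n + 1" using h(1) by (simp flip: ye)
    moreover have "odd (x * y)" "even (d * e)" by (simp_all flip: ye)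
    moreover have "(2 * j + 1) div x = y" "2 * (n - j) div d = e"
      unfolding ye using pos by simp_all
    ultimately show ?case using pos unfolding z by (simp add: quads_def N_def)
  qed auto
  also have "\<dots> = (\<Sum>j<n. \<Sum>x | x dvd 2 * j + 1. \<Sum>d | d dvd 2 * (n - j). F x d)"
    by (subst sum.Sigma[symmetric]) (auto simp: sum.cartesian_product)
  also have "\<dots> = (\<Sum>j<n. int (\<Sum>{d. d dvd 2 * j + 1}) * (8 * altsigma (n - j)))"
  proof (rule sum.cong[OF refl])
    fix j assume "j \<in> {..<n}"
    \<comment> \<open>Since \<open>x\<close> is odd, \<open>x + d\<close> and \<open>d\<close> have
      opposite parity, so the weight depends on \<open>d\<close> alone.\<close>
    have "(\<Sum>d | d dvd 2 * (n - j). F x d)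
        = int x * (\<Sum>d | d dvd 2 * (n - j). (if even d then - 4 else 16) * int d)"
      if "x dvd 2 * j + 1" for x
    proof -
      have "odd x"
      proof
        assume "even x"
        then have "even (2 * j + 1)" using that by (rule dvd_trans)
        then show False by simp
      qed
      then show ?thesis
        unfolding sum_distrib_left by (auto simp: F_def intro!: sum.cong)
    qed
    then show "(\<Sum>x | x dvd 2 * j + 1. \<Sum>d | d dvd 2 * (n - j). F x d)
        = int (\<Sum>{d. d dvd 2 * j + 1}) * (8 * altsigma (n - j))"
      using \<open>j \<in> {..<n}\<close> by (simp add: sum_divisors_double sum_distrib_right)
  qed
  also have "\<dots> = 8 * (\<Sum>j<n. int (\<Sum>{d. d dvd 2 * j + 1}) * altsigma (n - j))"
    by (simp add: sum_distrib_left algebra_simps)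
  \<comment> \<open>The two equal halves contribute 8 times the sum each; cancelling 4 against the
    Liouville evaluation leaves the factor 4.\<close>
  finally show ?thesis
    using liouville_signed_square[of n] unfolding F_def N_def by simp
qed

section \<open>Comparison of the recurrences and evaluation at primes\<close>

text \<open>Flipping the sign of the even divisors subtracts them twice, and they are the doubles of
  the divisors of b/2, hence the factor 4. At 0 the two sides would be 0 and -3, by the convention
  \<open>div_sigma 0 = 1\<close>.\<close>

lemma altsigma_eq_div_sigma:
  assumes "0 < b"
  shows "of_int (altsigma b) = (of_nat (div_sigma (of_nat b)) - 4 * of_nat (div_sigma (of_nat b / 2)) :: rat)"
proof -
  have "altsigma b = (\<Sum>d | d dvd b. int d) - 2 * (\<Sum>d | d dvd b. if even d then int d else 0)"
    unfolding altsigma_def sum_distrib_left sum_subtractf[symmetric] by (auto intro!: sum.cong)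
  moreover have "(\<Sum>d | d dvd b. if even d then int d else 0) = 2 * int (div_sigma (of_nat b / 2))"
  proof (cases "even b")
    case True
    then obtain c where c: "b = 2 * c" by (elim evenE)
    with assms have "0 < c" by simp
    have "(\<Sum>d | d dvd b. if even d then int d else 0) = (\<Sum>d\<in>(*) 2 ` {d. d dvd c}. int d)"
      using \<open>0 < c\<close> by (intro sum.mono_neutral_cong_right) (auto simp: c elim!: evenE)
    also have "\<dots> = (\<Sum>d | d dvd c. 2 * int d)"
      by (subst sum.reindex) (auto simp: inj_on_def)
    also have "\<dots> = 2 * int (div_sigma (of_nat c))"
      using \<open>0 < c\<close> by (simp add: div_sigma_of_nat sum_distrib_left)
    finally show ?thesis by (simp add: c)
  next
    case False
    then have "(of_nat b / 2 :: rat) \<notin> \<nat>"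
    proof (intro notI, elim Nats_cases)
      fix k assume "of_nat b / 2 = (of_nat k :: rat)"
      then have "of_nat b = (of_nat (2 * k) :: rat)" by simp
      then have "b = 2 * k" unfolding of_nat_eq_iff .
      then show False using False by simp
    qed
    moreover have "(\<Sum>d | d dvd b. if even d then int d else 0) = 0"
      using False by (intro sum.neutral) (auto dest: dvd_trans)
    ultimately show ?thesis using assms by (simp add: div_sigma_def)
  qed
  ultimately show ?thesis using assms by (simp add: div_sigma_of_nat)
qed

text \<open>The recurrence reads 0 = 0 at \<open>n = 0\<close>, so the initial value comes from the
  constant coefficient of \<open>psi\<close>.\<close>

lemma t4_0: "t4 0 = 1"
proof -
  have "triang k = 0 \<longleftrightarrow> k = 0" for k
    using le_triang[of k] by (auto simp: triang_def)
  then have zero: "{k. triang k = 0} = {0}"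
    by simp
  have "card {k. triang k = 0} = 1"
    unfolding zero by simp
  then have "fps_nth psi 0 = 1"
    unfolding psi_def fps_nth_Abs_fps by (simp only: of_nat_1)
  then have "of_nat (t4 0) = (1 :: rat)"
    by (simp only: psi_power4_nth[symmetric] fps_nth_power_0 power_one)
  then show ?thesis
    by (simp only: of_nat_eq_1_iff)
qed

text \<open>Legendre's theorem on four triangular numbers: both sides satisfy the same recurrence,
  which determines the value at \<open>n > 0\<close> from the earlier ones after division by
  \<open>n\<close>.\<close>

theorem t4_eq_sum_divisors: "t4 n = \<Sum>{d. d dvd 2 * n + 1}"
proof (induction n rule: less_induct)
  case (less n)
  show ?case
  proof (cases "n = 0")
    case True
    then show ?thesis by (simp add: t4_0)
  next
    case False
    have "of_int (int n * int (\<Sum>{d. d dvd 2 * n + 1}))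
        = (4 * (\<Sum>j<n. of_nat (\<Sum>{d. d dvd 2 * j + 1}) * of_int (altsigma (n - j))) :: rat)"
      unfolding sigma_odd_recurrence by (simp only: of_int_mult of_int_sum of_int_numeral of_int_of_nat_eq)
    also have "\<dots> = of_nat (n * t4 n)"
      unfolding t4_recurrence by (simp add: less.IH)
    finally have "(of_nat (n * \<Sum>{d. d dvd 2 * n + 1}) :: rat) = of_nat (n * t4 n)"
      by (simp only: of_int_mult of_int_of_nat_eq of_nat_mult)
    then have "n * \<Sum>{d. d dvd 2 * n + 1} = n * t4 n"
      unfolding of_nat_eq_iff .
    then show ?thesis using False by simp
  qed
qed

theorem theorem4p2:
  fixes n :: nat
  assumes "prime (2 * n + 1)"
  shows "(\<Sum>j<n. of_nat (t4 j) *
           (of_nat (div_sigma (of_nat (n - j))) - 4 * of_nat (div_sigma (of_nat (n - j) / 2))))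
         = (of_nat n * (of_nat n + 1) / 2 :: rat)"
proof -
  have "{d. d dvd 2 * n + 1} = {1, 2 * n + 1}"
    using assms unfolding prime_nat_iff by auto
  \<comment> \<open>This makes the divisors 1 and \<open>2 * n + 1\<close> distinct, so that they
    add up to \<open>2 * n + 2\<close>.\<close>
  moreover have "n \<noteq> 0" using assms by (intro notI) simp
  ultimately have "t4 n = 2 * n + 2"
    unfolding t4_eq_sum_divisors by simp
  moreover have "(\<Sum>j<n. of_nat (t4 j) *
           (of_nat (div_sigma (of_nat (n - j))) - 4 * of_nat (div_sigma (of_nat (n - j) / 2))))
         = (\<Sum>j<n. of_nat (t4 j) * of_int (altsigma (n - j)) :: rat)"
    by (intro sum.cong refl) (simp add: altsigma_eq_div_sigma)
  \<comment> \<open>The recurrence gives one quarter of n(2n + 2).\<close>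
  ultimately show ?thesis
    using t4_recurrence[of n] by (simp add: algebra_simps)
qed

end
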